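(* Let $\mathcal{M}=(\mathbb{R}^2,\nabla)$ where $\nabla$ is a torsion-free connection with constant Christoffel symbols $\Gamma_{ij}{}^k\in\mathbb{R}$ and with Ricci tensor $\rho\ne0$. The following assertions are equivalent: \begin{enumerate} \item $\operatorname{Rank}\{\rho\}=1$. \item $\mathfrak{A}(\mathcal{M})$ is non-empty. \end{enumerate}
   Context: $\nabla_{\partial_i}\partial_j=\Gamma_{ij}{}^k\partial_k$. $R(\xi_1,\xi_2)=\nabla_{\xi_1}\nabla_{\xi_2}-\nabla_{\xi_2}\nabla_{\xi_1}-\nabla_{[\xi_1,\xi_2]}$ and $\rho(\xi_1,\xi_2)=\operatorname{Tr}\{\xi_3\mapsto R(\xi_3,\xi_1)\xi_2\}$; $\rho$ is symmetric when the Christoffel symbols are constant. The Hessian of $f$ is $H_f^\nabla=\nabla(df)$. $\mathfrak{A}(\mathcal{M})$ is the set of $f\in C^\infty(M)$ such that $(M,\nabla,f)$ is an affine gradient Ricci soliton, i.e. $H_f^\nabla+\rho^s=0$, where $\rho^s$ is the symmetrization of $\rho$ (here $\rho^s=\rho$). *)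

theory Defs
  imports "HOL-Analysis.Analysis"
begin

section \<open>Smooth maps and vector fields on the plane\<close>

primrec C_diff :: "nat \<Rightarrow> ('a::euclidean_space \<Rightarrow> 'b::real_normed_vector) \<Rightarrow> bool" where
  "C_diff 0 f \<longleftrightarrow> continuous_on UNIV f"
| "C_diff (Suc n) f \<longleftrightarrow>
     (\<forall>x. f differentiable (at x)) \<and>
     (\<forall>b\<in>Basis. C_diff n (\<lambda>x. frechet_derivative f (at x) b))"

definition smooth :: "('a::euclidean_space \<Rightarrow> 'b::real_normed_vector) \<Rightarrow> bool" where
  "smooth f \<longleftrightarrow> (\<forall>n. C_diff n f)"

type_synonym plane = "real ^ 2"
type_synonym vfield = "plane \<Rightarrow> plane"

text \<open>A 1-form is a map \<open>\<omega>\<close> with \<open>\<omega> p v\<close> the value at the point \<open>p\<close> on the tangent vector \<open>v\<close>.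
  A (0,2)-tensor field \<open>T\<close> is given by its action on pairs of vector fields, \<open>T X Y p\<close> being
  the value of \<open>T(X,Y)\<close> at \<open>p\<close>.\<close>

type_synonym form1 = "plane \<Rightarrow> plane \<Rightarrow> real"
type_synonym tensor2 = "vfield \<Rightarrow> vfield \<Rightarrow> plane \<Rightarrow> real"

definition coord_field :: "2 \<Rightarrow> vfield" where
  "coord_field i = (\<lambda>_. axis i 1)"

definition lie_bracket :: "vfield \<Rightarrow> vfield \<Rightarrow> vfield" where
  "lie_bracket X Y p = frechet_derivative Y (at p) (X p) - frechet_derivative X (at p) (Y p)"

definition tensor_zero :: "tensor2 \<Rightarrow> bool" where
  "tensor_zero T \<longleftrightarrow> (\<forall>X Y. smooth X \<longrightarrow> smooth Y \<longrightarrow> (\<forall>p. T X Y p = 0))"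

definition tensor_rank :: "tensor2 \<Rightarrow> plane \<Rightarrow> nat" where
  "tensor_rank T p = rank (\<chi> i j. T (coord_field i) (coord_field j) p)"

section \<open>Connections with constant Christoffel symbols\<close>

text \<open>\<open>\<Gamma> i j k\<close> is the Christoffel symbol with lower indices \<open>i j\<close> and upper index \<open>k\<close>, and
  \<open>nabla \<Gamma>\<close> is the connection of the plane that sends the pair of the \<open>i\<close>-th and \<open>j\<close>-th
  coordinate fields to the sum over \<open>k\<close> of \<open>\<Gamma> i j k\<close> times the \<open>k\<close>-th coordinate field.\<close>

type_synonym christoffel = "2 \<Rightarrow> 2 \<Rightarrow> 2 \<Rightarrow> real"

definition nabla :: "christoffel \<Rightarrow> vfield \<Rightarrow> vfield \<Rightarrow> vfield" where
  "nabla \<Gamma> X Y p =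
     frechet_derivative Y (at p) (X p) + (\<chi> k. \<Sum>i\<in>UNIV. \<Sum>j\<in>UNIV. \<Gamma> i j k * X p $ i * Y p $ j)"

definition torsion_free :: "christoffel \<Rightarrow> bool" where
  "torsion_free \<Gamma> \<longleftrightarrow>
     (\<forall>X Y. smooth X \<longrightarrow> smooth Y \<longrightarrow>
        (\<forall>p. nabla \<Gamma> X Y p - nabla \<Gamma> Y X p - lie_bracket X Y p = 0))"

definition curvature :: "christoffel \<Rightarrow> vfield \<Rightarrow> vfield \<Rightarrow> vfield \<Rightarrow> vfield" where
  "curvature \<Gamma> X Y Z p =
     nabla \<Gamma> X (nabla \<Gamma> Y Z) p - nabla \<Gamma> Y (nabla \<Gamma> X Z) p - nabla \<Gamma> (lie_bracket X Y) Z p"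

text \<open>The trace is that of the endomorphism \<open>v \<mapsto> R(v,X)Y\<close> of the tangent space at \<open>p\<close>, where
  the tangent vector \<open>v\<close> is extended to a constant vector field.\<close>

definition ricci :: "christoffel \<Rightarrow> tensor2" where
  "ricci \<Gamma> X Y p = trace (matrix (\<lambda>v. curvature \<Gamma> (\<lambda>_. v) X Y p))"

definition ricci_sym :: "christoffel \<Rightarrow> tensor2" where
  "ricci_sym \<Gamma> X Y p = (ricci \<Gamma> X Y p + ricci \<Gamma> Y X p) / 2"

definition differential :: "(plane \<Rightarrow> real) \<Rightarrow> form1" where
  "differential f p v = frechet_derivative f (at p) v"

text \<open>The induced connection on 1-forms: \<open>(\<nabla>\<^sub>X \<omega>)(Y) = X(\<omega>(Y)) - \<omega>(\<nabla>\<^sub>X Y)\<close>.\<close>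

definition nabla_form :: "christoffel \<Rightarrow> form1 \<Rightarrow> tensor2" where
  "nabla_form \<Gamma> \<omega> X Y p =
     frechet_derivative (\<lambda>q. \<omega> q (Y q)) (at p) (X p) - \<omega> p (nabla \<Gamma> X Y p)"

definition hessian :: "christoffel \<Rightarrow> (plane \<Rightarrow> real) \<Rightarrow> tensor2" where
  "hessian \<Gamma> f = nabla_form \<Gamma> (differential f)"

definition affine_solitons :: "christoffel \<Rightarrow> (plane \<Rightarrow> real) set" where
  "affine_solitons \<Gamma> =
     {f. smooth f \<and> tensor_zero (\<lambda>X Y p. hessian \<Gamma> f X Y p + ricci_sym \<Gamma> X Y p)}"

end

theory Submission
  imports Defs
begin

text \<open>If the Ricci tensor has rank one, it is \<open>s l \<otimes> l\<close> for a constant covector \<open>l\<close>. The kernel of \<open>l\<close>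
  then also annihilates \<open>l(\<nabla>\<^sub>X Y)\<close> for constant fields \<open>X, Y\<close>, so that \<open>l(\<nabla>\<^sub>X Y) = \<mu> l(X) l(Y)\<close>, and
  the soliton equation for a function of \<open>l(p)\<close> alone becomes the ordinary differential equation
  \<open>\<phi>'' - \<mu> \<phi>' + s = 0\<close>, which has a linear or quadratic solution.

  Conversely, the soliton equation is \<open>\<partial>\<^sub>i g\<^sub>j = \<Gamma>\<^sub>i\<^sub>j\<^sup>k g\<^sub>k - \<rho>\<^sub>i\<^sub>j\<close> for the gradient \<open>g\<close> of the soliton function.
  Equality of mixed derivatives of \<open>g\<close> is a linear system for \<open>g\<close> with constant coefficients, whose matrix
  is given by \<open>\<rho>\<close>. If \<open>\<rho>\<close> were invertible, \<open>g\<close> would be constant, hence \<open>\<rho>\<^sub>i\<^sub>j = \<Gamma>\<^sub>i\<^sub>j\<^sup>k g\<^sub>k\<close>; inserting this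
  in the quadratic formula for \<open>\<rho>\<close> forces \<open>det \<rho> = 0\<close>.\<close>

section \<open>Symmetry of second derivatives\<close>

text \<open>The second difference is the increment over \<open>[0, t]\<close> of
  \<open>f (x + s u + t w) - f (x + s u)\<close> as a function of \<open>s\<close>. Its derivative
  is \<open>t G w + o(t)\<close> uniformly in \<open>s\<close>, so the mean value inequality gives
  \<open>t^2 G w + o(t^2)\<close>.\<close>

lemma second_difference_quotient_tendsto:
  fixes f :: "'a::real_normed_vector \<Rightarrow> 'b::real_normed_vector"
  assumes f: "\<And>y. (f has_derivative f' y) (at y)"
    and G: "((\<lambda>y. f' y u) has_derivative G) (at x)"
  shows "((\<lambda>t. (f (x + t *\<^sub>R u + t *\<^sub>R w) - f (x + t *\<^sub>R u) - f (x + t *\<^sub>R w) + f x) /\<^sub>R t\<^sup>2)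
           \<longlongrightarrow> G w) (at_right 0)"
proof (rule tendstoI)
  fix e :: real
  assume e: "e > 0"
  define N where "N = norm u + norm w + 1"
  \<comment> \<open>Two errors of size at most \<open>c * (t * N)\<close> will be added, and
    \<open>2 * c * N\<close> is \<open>e / 2\<close>.\<close>
  define c where "c = e / (4 * N)"
  have N: "N > 0" "norm u \<le> N" "norm w \<le> N"
    by (auto simp: N_def add_pos_nonneg add.commute add_nonneg_pos)
  have c: "c > 0" and cN: "2 * c * N < e"
    using e N by (auto simp: c_def field_simps)
  interpret G: bounded_linear G
    using G by (rule has_derivative_bounded_linear)
  obtain d where d: "d > 0"
    and dG: "\<And>y. norm (y - x) < d \<Longrightarrow> norm (f' y u - f' x u - G (y - x)) \<le> c * norm (y - x)"
    using G c unfolding has_derivative_at_alt by blast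
  have "dist ((f (x + t *\<^sub>R u + t *\<^sub>R w) - f (x + t *\<^sub>R u) - f (x + t *\<^sub>R w) + f x) /\<^sub>R t\<^sup>2) (G w) < e"
    if t: "0 < t" "t < d / N" for t
  proof -
    have tN: "t * N < d"
      using t N by (simp add: pos_less_divide_eq)
    have small: "norm (s *\<^sub>R u + r *\<^sub>R w) \<le> t * N"
      if "0 \<le> s" "s \<le> t" "0 \<le> r" "r \<le> t" for s r
    proof -
      have "norm (s *\<^sub>R u + r *\<^sub>R w) \<le> s * norm u + r * norm w"
        using norm_triangle_ineq[of "s *\<^sub>R u" "r *\<^sub>R w"] that by simp
      also have "\<dots> \<le> t * norm u + t * norm w"
        using that by (intro add_mono mult_right_mono) auto
      also have "\<dots> \<le> t * N"
        using t by (simp add: N_def algebra_simps)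
      finally show ?thesis .
    qed
    \<comment> \<open>Subtracting the expected main term leaves only the error, so a bound on
      \<open>\<psi>'\<close> suffices.\<close>
    define \<psi> where "\<psi> = (\<lambda>s. f (x + s *\<^sub>R u + t *\<^sub>R w) - f (x + s *\<^sub>R u) - s *\<^sub>R t *\<^sub>R G w)"
    define \<psi>' where "\<psi>' = (\<lambda>s. f' (x + s *\<^sub>R u + t *\<^sub>R w) u - f' (x + s *\<^sub>R u) u - t *\<^sub>R G w)"
    have along: "((\<lambda>s. f (x + s *\<^sub>R u + v)) has_vector_derivative f' (x + s *\<^sub>R u + v) u) (at s)" for s v
    proof -
      interpret f': bounded_linear "f' y" for y
        using f by (rule has_derivative_bounded_linear)
      have "((\<lambda>s. x + s *\<^sub>R u + v) has_derivative (\<lambda>h. h *\<^sub>R u)) (at s)"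
        by (auto intro!: derivative_eq_intros)
      from has_derivative_compose[OF this f] show ?thesis
        by (simp add: has_vector_derivative_def f'.scaleR)
    qed
    have \<psi>: "(\<psi> has_vector_derivative \<psi>' s) (at s)" for s
      unfolding \<psi>_def \<psi>'_def using along[of 0 s] along[of "t *\<^sub>R w" s]
      by (auto intro!: derivative_eq_intros)
    moreover have "norm (\<psi>' s) \<le> 2 * c * (t * N)" if s: "0 \<le> s" "s \<le> t" for s
    proof -
      let ?a = "f' (x + (s *\<^sub>R u + t *\<^sub>R w)) u - f' x u - G (s *\<^sub>R u + t *\<^sub>R w)"
      let ?b = "f' (x + (s *\<^sub>R u + 0 *\<^sub>R w)) u - f' x u - G (s *\<^sub>R u + 0 *\<^sub>R w)"
      have bound: "norm (f' (x + (s *\<^sub>R u + r *\<^sub>R w)) u - f' x u - G (s *\<^sub>R u + r *\<^sub>R w)) \<le> c * (t * N)"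
        if r: "0 \<le> r" "r \<le> t" for r
      proof -
        have le: "norm (s *\<^sub>R u + r *\<^sub>R w) \<le> t * N"
          using small s r by simp
        then have "norm (f' (x + (s *\<^sub>R u + r *\<^sub>R w)) u - f' x u - G (s *\<^sub>R u + r *\<^sub>R w))
            \<le> c * norm (s *\<^sub>R u + r *\<^sub>R w)"
          using dG[of "x + (s *\<^sub>R u + r *\<^sub>R w)"] tN by simp
        also have "\<dots> \<le> c * (t * N)"
          using le c by simp
        finally show ?thesis .
      qed
      have "\<psi>' s = ?a - ?b"
        by (simp add: \<psi>'_def G.add G.scaleR algebra_simps)
      also have "norm \<dots> \<le> norm ?a + norm ?b"
        by (rule norm_triangle_ineq4)
      also have "\<dots> \<le> 2 * c * (t * N)"
        using bound[of t] bound[of 0] t by simp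
      finally show ?thesis .
    qed
    ultimately have "norm (\<psi> t - \<psi> 0) \<le> 2 * c * (t * N) * t - 2 * c * (t * N) * 0"
      using t has_vector_derivative_continuous[OF \<psi>]
      by (intro differentiable_bound_general[where f' = \<psi>' and \<phi>' = "\<lambda>_. 2 * c * (t * N)"])
         (auto intro!: continuous_intros continuous_at_imp_continuous_on derivative_eq_intros)
    then have "norm (\<psi> t - \<psi> 0) / t\<^sup>2 \<le> 2 * c * N"
      using t by (simp add: pos_divide_le_eq power2_eq_square algebra_simps)
    then have "norm ((\<psi> t - \<psi> 0) /\<^sub>R t\<^sup>2) \<le> 2 * c * N"
      by (simp add: divide_inverse mult.commute)
    moreover have "(f (x + t *\<^sub>R u + t *\<^sub>R w) - f (x + t *\<^sub>R u) - f (x + t *\<^sub>R w) + f x) /\<^sub>R t\<^sup>2 - G w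
        = (\<psi> t - \<psi> 0) /\<^sub>R t\<^sup>2"
      using t by (simp add: \<psi>_def algebra_simps power2_eq_square)
    ultimately have "norm ((f (x + t *\<^sub>R u + t *\<^sub>R w) - f (x + t *\<^sub>R u) - f (x + t *\<^sub>R w) + f x) /\<^sub>R t\<^sup>2 - G w)
        \<le> 2 * c * N"
      by simp
    then show ?thesis
      using cN by (simp add: dist_norm)
  qed
  moreover have "\<forall>\<^sub>F t in at_right 0. 0 < t \<and> t < d / N"
    using d N eventually_at_right_real[of 0 "d / N"] by simp
  ultimately show "\<forall>\<^sub>F t in at_right 0.
      dist ((f (x + t *\<^sub>R u + t *\<^sub>R w) - f (x + t *\<^sub>R u) - f (x + t *\<^sub>R w) + f x) /\<^sub>R t\<^sup>2) (G w) < e"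
    by (auto elim: eventually_mono)
qed

text \<open>The second difference quotient is unchanged when \<open>u\<close> and \<open>w\<close>
  are exchanged, so both values are its limit.\<close>

lemma second_derivative_symmetric:
  fixes f :: "'a::real_normed_vector \<Rightarrow> 'b::real_normed_vector"
  assumes f: "\<And>y. (f has_derivative f' y) (at y)"
    and G: "((\<lambda>y. f' y u) has_derivative G) (at x)"
    and H: "((\<lambda>y. f' y w) has_derivative H) (at x)"
  shows "G w = H u"
proof -
  have "((\<lambda>t. (f (x + t *\<^sub>R u + t *\<^sub>R w) - f (x + t *\<^sub>R u) - f (x + t *\<^sub>R w) + f x) /\<^sub>R t\<^sup>2)
      \<longlongrightarrow> H u) (at_right 0)"
    using second_difference_quotient_tendsto[OF f H, of u] by (simp add: algebra_simps)
  with second_difference_quotient_tendsto[OF f G, of w] show ?thesis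
    by (rule tendsto_unique[OF trivial_limit_at_right_real])
qed

section \<open>Derivatives along vector fields\<close>

lemma frechet_derivative_eq:
  "(f has_derivative f') (at x) \<Longrightarrow> frechet_derivative f (at x) = f'"
  by (rule frechet_derivative_at[symmetric])

lemma C_diff_Suc_has_derivative:
  "C_diff (Suc n) f \<Longrightarrow> (f has_derivative frechet_derivative f (at x)) (at x)"
  by (simp add: frechet_derivative_works[symmetric])

text \<open>\<open>C_diff\<close> speaks of derivatives in basis directions only; expanding
  \<open>Y y\<close> in the basis reduces the claim to the product rule.\<close>

lemma has_derivative_directional:
  fixes f :: "'a::euclidean_space \<Rightarrow> 'b::real_normed_vector"
  assumes f: "C_diff (Suc (Suc n)) f" and Y: "Y differentiable (at x)"
  shows "((\<lambda>y. frechet_derivative f (at y) (Y y)) has_derivative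
      (\<lambda>v. frechet_derivative (\<lambda>y. frechet_derivative f (at y) (Y x)) (at x) v
         + frechet_derivative f (at x) (frechet_derivative Y (at x) v))) (at x)"
proof -
  let ?D = "\<lambda>y. frechet_derivative f (at y)"
  have lin: "linear (?D y)" for y
    using f by (auto intro: linear_frechet_derivative)
  have expand: "?D y v = (\<Sum>b\<in>Basis. (v \<bullet> b) *\<^sub>R ?D y b)" for y v
  proof -
    have "?D y v = ?D y (\<Sum>b\<in>Basis. (v \<bullet> b) *\<^sub>R b)"
      by (simp add: euclidean_representation)
    then show ?thesis
      by (simp add: linear_sum[OF lin] linear_cmul[OF lin])
  qed
  have D: "((\<lambda>y. ?D y b) has_derivative frechet_derivative (\<lambda>y. ?D y b) (at x)) (at x)" if "b \<in> Basis" for b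
    using f that by (auto simp: frechet_derivative_works[symmetric])
  have Y': "(Y has_derivative frechet_derivative Y (at x)) (at x)"
    using Y by (simp add: frechet_derivative_works)
  have prod: "((\<lambda>y. ?D y (Z y)) has_derivative (\<lambda>v.
       (\<Sum>b\<in>Basis. (Z x \<bullet> b) *\<^sub>R frechet_derivative (\<lambda>y. ?D y b) (at x) v) + ?D x (Z' v))) (at x)"
    if Z: "(Z has_derivative Z') (at x)" for Z Z'
    by (subst expand, subst (2) expand, subst sum.distrib[symmetric])
       (rule has_derivative_sum, intro has_derivative_scaleR has_derivative_inner_left Z D)
  \<comment> \<open>Applying \<open>prod\<close> to the constant field with value \<open>Y x\<close>
    identifies the basis sum.\<close>
  have "frechet_derivative (\<lambda>y. ?D y (Y x)) (at x)
      = (\<lambda>v. \<Sum>b\<in>Basis. (Y x \<bullet> b) *\<^sub>R frechet_derivative (\<lambda>y. ?D y b) (at x) v)"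
    using prod[OF has_derivative_const[of "Y x"]] linear_0[OF lin]
    by (intro frechet_derivative_eq) simp
  with prod[OF Y'] show ?thesis
    by simp
qed

lemma C_diff_second_derivative_symmetric:
  fixes f :: "'a::euclidean_space \<Rightarrow> 'b::real_normed_vector"
  assumes "C_diff (Suc (Suc n)) f"
  shows "frechet_derivative (\<lambda>y. frechet_derivative f (at y) u) (at x) w
       = frechet_derivative (\<lambda>y. frechet_derivative f (at y) w) (at x) u"
proof -
  have "(\<lambda>y. frechet_derivative f (at y) v) differentiable (at x)" for v
    using has_derivative_directional[OF assms, of "\<lambda>_. v" x] by (auto intro: differentiableI)
  then show ?thesis
    using second_derivative_symmetric[OF C_diff_Suc_has_derivative[OF assms]]
    by (metis frechet_derivative_works)
qed

section \<open>Curvature of constant Christoffel symbols\<close>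

text \<open>The order-zero part of the connection, isolated so that the product rule for bilinear
  maps applies to it.\<close>

definition christoffel_map :: "christoffel \<Rightarrow> plane \<Rightarrow> plane \<Rightarrow> plane" where
  "christoffel_map \<Gamma> x y = (\<chi> k. \<Sum>i\<in>UNIV. \<Sum>j\<in>UNIV. \<Gamma> i j k * x $ i * y $ j)"

text \<open>For constant Christoffel symbols the curvature formula has no derivative terms.\<close>

definition ricci_coeff :: "christoffel \<Rightarrow> 2 \<Rightarrow> 2 \<Rightarrow> real" where
  "ricci_coeff \<Gamma> j k = (\<Sum>i\<in>UNIV. \<Sum>m\<in>UNIV. \<Gamma> j k m * \<Gamma> i m i - \<Gamma> i k m * \<Gamma> j m i)"

lemma bounded_bilinear_christoffel_map: "bounded_bilinear (christoffel_map \<Gamma>)"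
  unfolding bilinear_conv_bounded_bilinear[symmetric] bilinear_def
  by (auto intro!: linearI simp: christoffel_map_def vec_eq_iff sum_2 algebra_simps)

lemma nabla_eq: "nabla \<Gamma> X Y p = frechet_derivative Y (at p) (X p) + christoffel_map \<Gamma> (X p) (Y p)"
  by (simp add: nabla_def christoffel_map_def)

lemma smooth_const: "smooth (\<lambda>_::'a::euclidean_space. c::'b::real_normed_vector)"
proof -
  have "C_diff n (\<lambda>_::'a. d)" for n and d :: 'b
    by (induction n arbitrary: d) auto
  then show ?thesis
    by (simp add: smooth_def)
qed

lemma smooth_differentiable: "smooth f \<Longrightarrow> f differentiable (at x)"
  unfolding smooth_def by (metis C_diff.simps(2))

lemma smooth_C_diff_2: "smooth f \<Longrightarrow> C_diff (Suc (Suc 0)) f"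
  unfolding smooth_def by blast

lemma smooth_frechet_derivative:
  "smooth f \<Longrightarrow> b \<in> Basis \<Longrightarrow> smooth (\<lambda>x. frechet_derivative f (at x) b)"
  unfolding smooth_def by (metis C_diff.simps(2))

text \<open>The second derivatives of \<open>Y\<close> cancel by symmetry, the derivatives of
  \<open>X\<close> against the bracket term, and the remaining first derivatives of \<open>Y\<close>
  in pairs.\<close>

lemma curvature_const:
  assumes X: "smooth X" and Y: "smooth Y"
  shows "curvature \<Gamma> (\<lambda>_. v) X Y p = 
    christoffel_map \<Gamma> v (christoffel_map \<Gamma> (X p) (Y p)) - christoffel_map \<Gamma> (X p) (christoffel_map \<Gamma> v (Y p))"
proof -
  interpret B: bounded_bilinear "christoffel_map \<Gamma>"
    by (rule bounded_bilinear_christoffel_map)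
  let ?D = "\<lambda>F. frechet_derivative F (at p)"
  let ?D2 = "\<lambda>u. ?D (\<lambda>q. frechet_derivative Y (at q) u)"
  have dX: "(X has_derivative ?D X) (at p)" and dY: "(Y has_derivative ?D Y) (at p)"
    using X Y by (simp_all add: frechet_derivative_works[symmetric] smooth_differentiable)
  have lie: "lie_bracket (\<lambda>_. v) X = (\<lambda>q. frechet_derivative X (at q) v)"
    by (simp add: lie_bracket_def fun_eq_iff)
  have D: "((\<lambda>q. frechet_derivative Y (at q) (Z q)) has_derivative
      (\<lambda>w. ?D2 (Z p) w + ?D Y (?D Z w))) (at p)" if "Z differentiable (at p)" for Z
    by (rule has_derivative_directional[OF smooth_C_diff_2[OF Y] that])
  have "?D (nabla \<Gamma> X Y) = (\<lambda>w. (?D2 (X p) w + ?D Y (?D X w))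
      + (christoffel_map \<Gamma> (X p) (?D Y w) + christoffel_map \<Gamma> (?D X w) (Y p)))"
    unfolding nabla_eq[abs_def]
    by (intro frechet_derivative_eq has_derivative_add D smooth_differentiable[OF X] B.FDERIV dX dY)
  moreover have "?D (nabla \<Gamma> (\<lambda>_. v) Y) = (\<lambda>w. (?D2 v w + ?D Y (?D (\<lambda>_. v) w))
      + (christoffel_map \<Gamma> v (?D Y w) + christoffel_map \<Gamma> 0 (Y p)))"
    unfolding nabla_eq[abs_def]
    by (intro frechet_derivative_eq has_derivative_add D differentiable_const B.FDERIV has_derivative_const dY)
  moreover have "?D2 (X p) v = ?D2 v (X p)"
    by (rule C_diff_second_derivative_symmetric[OF smooth_C_diff_2[OF Y]])
  moreover have "?D Y 0 = 0"
    using Y by (intro linear_0 linear_frechet_derivative smooth_differentiable)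
  ultimately show ?thesis
    by (simp add: curvature_def nabla_eq[of _ _ "nabla _ _ _"] nabla_eq[of _ _ Y] nabla_eq[of _ "lie_bracket _ _"] lie
        B.zero_left B.add_right B.add_left algebra_simps)
qed

section \<open>Ricci tensor and Hessian in components\<close>

lemma ricci_eq:
  assumes "smooth X" "smooth Y"
  shows "ricci \<Gamma> X Y p = (\<Sum>j\<in>UNIV. \<Sum>k\<in>UNIV. ricci_coeff \<Gamma> j k * X p $ j * Y p $ k)"
  using assms
  by (simp add: ricci_def curvature_const trace_def matrix_def christoffel_map_def ricci_coeff_def
      axis_def sum_2 algebra_simps)

lemma smooth_coord_field: "smooth (coord_field i)"
  unfolding coord_field_def by (rule smooth_const)

lemma ricci_coord_field: "ricci \<Gamma> (coord_field i) (coord_field j) p = ricci_coeff \<Gamma> i j"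
  unfolding ricci_eq[OF smooth_coord_field smooth_coord_field]
  by (simp add: coord_field_def axis_def if_distrib[of "\<lambda>x. _ * x"] cong: if_cong)

lemma torsion_free_symmetric:
  assumes "torsion_free \<Gamma>"
  shows "\<Gamma> i j k = \<Gamma> j i k"
proof -
  have "nabla \<Gamma> (coord_field i) (coord_field j) 0 - nabla \<Gamma> (coord_field j) (coord_field i) 0
      - lie_bracket (coord_field i) (coord_field j) 0 = 0"
    using assms smooth_coord_field unfolding torsion_free_def by blast
  then have "christoffel_map \<Gamma> (axis i 1) (axis j 1) $ k = christoffel_map \<Gamma> (axis j 1) (axis i 1) $ k"
    by (simp add: nabla_eq lie_bracket_def coord_field_def)
  then show ?thesis
    by (simp add: christoffel_map_def axis_def if_distrib[of "\<lambda>x. _ * x"] cong: if_cong)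
qed

text \<open>With symmetric lower indices, the subtracted sum is the trace of the product of the
  matrices of \<open>christoffel_map\<close> at the two basis vectors, which does not depend on
  their order.\<close>

lemma ricci_coeff_symmetric:
  assumes "\<And>i j k. \<Gamma> i j k = \<Gamma> j i k"
  shows "ricci_coeff \<Gamma> i j = ricci_coeff \<Gamma> j i"
  using assms[of 1 2] exhaust_2[of i] exhaust_2[of j]
  by (auto simp: ricci_coeff_def sum_2 algebra_simps)

text \<open>The derivative of \<open>Y\<close> arising from \<open>df(Y)\<close> cancels against the
  one inside \<open>nabla\<close>.\<close>

lemma hessian_eq:
  assumes f: "smooth f" and Y: "smooth Y"
  shows "hessian \<Gamma> f X Y p =
    frechet_derivative (\<lambda>q. frechet_derivative f (at q) (Y p)) (at p) (X p)
      - frechet_derivative f (at p) (christoffel_map \<Gamma> (X p) (Y p))"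
proof -
  have "linear (frechet_derivative f (at p))"
    using f by (intro linear_frechet_derivative smooth_differentiable)
  then show ?thesis
    using frechet_derivative_eq[OF has_derivative_directional[OF smooth_C_diff_2[OF f] smooth_differentiable[OF Y]]]
    by (simp add: hessian_def nabla_form_def differential_def nabla_eq linear_add)
qed

lemma tensor_rank_ricci:
  "tensor_rank (ricci \<Gamma>) p = 1 \<longleftrightarrow>
     ricci_coeff \<Gamma> 1 1 * ricci_coeff \<Gamma> 2 2 = ricci_coeff \<Gamma> 1 2 * ricci_coeff \<Gamma> 2 1
     \<and> (\<exists>i j. ricci_coeff \<Gamma> i j \<noteq> 0)"
proof -
  let ?A = "\<chi> i j. ricci_coeff \<Gamma> i j"
  have "rank ?A = 1 \<longleftrightarrow> rank ?A < CARD(2) \<and> rank ?A \<noteq> 0"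
    by auto
  also have "\<dots> \<longleftrightarrow> det ?A = 0 \<and> ?A \<noteq> 0"
    by (simp only: det_eq_0_rank rank_eq_0)
  finally show ?thesis
    by (simp add: tensor_rank_def ricci_coord_field det_2 vec_eq_iff)
qed

section \<open>Algebra of the Ricci tensor\<close>

text \<open>In the next three lemmas \<open>a, b, c, d, e, f\<close> are the Christoffel symbols \<open>\<Gamma>\<^sub>1\<^sub>1\<^sup>1, \<Gamma>\<^sub>1\<^sub>1\<^sup>2, \<Gamma>\<^sub>1\<^sub>2\<^sup>1, \<Gamma>\<^sub>1\<^sub>2\<^sup>2,
  \<Gamma>\<^sub>2\<^sub>2\<^sup>1, \<Gamma>\<^sub>2\<^sub>2\<^sup>2\<close>, and \<open>r11, r12, r22\<close> are the components of the Ricci tensor.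

  The primed quantities are the Christoffel symbols in the basis \<open>\<partial>\<^sub>1 - u \<partial>\<^sub>2, \<partial>\<^sub>2\<close>, whose first vector
  spans the kernel of the Ricci tensor.\<close>

lemma ricci_rank_one_algebra:
  fixes a b c d e f :: real
  defines "r11 \<equiv> d * (a - d) + b * (f - c)"
    and "r12 \<equiv> c * d - b * e"
    and "r22 \<equiv> c * (f - c) + e * (a - d)"
  assumes det: "r11 * r22 = r12 * r12" and nz: "r22 \<noteq> 0"
  shows "\<exists>u l. r11 = r22 * u * u \<and> r12 = r22 * u
    \<and> a * u + b = l * u * u \<and> c * u + d = l * u \<and> e * u + f = l"
proof -
  \<comment> \<open>This choice makes the first vector of the new basis orthogonal to the second for
    the Ricci tensor; since the determinant vanishes, it then lies in the kernel. The symbol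
    \<open>e\<close> is unchanged in this basis.\<close>
  define u where "u = r12 / r22"
  define a' where "a' = a - 2 * u * c + u * u * e"
  define c' where "c' = c - u * e"
  define f' where "f' = u * e + f"
  define b' where "b' = a * u + b - 2 * u * (c * u + d) + u * u * f'"
  define d' where "d' = c * u + d - u * f'"
  have r12: "r12 = r22 * u" and r11: "r11 = r22 * u * u"
    using nz det by (auto simp: u_def field_simps power2_eq_square)
  \<comment> \<open>The Ricci tensor transforms tensorially, so the same polynomials in the new
    symbols give its components in the new basis.\<close>
  have 1: "d' * (a' - d') + b' * (f' - c') = r11 - 2 * u * r12 + u * u * r22"
    unfolding assms(1-3) a'_def b'_def c'_def d'_def f'_def by algebra
  have 2: "c' * d' - b' * e = r12 - u * r22"
    unfolding assms(1-3) a'_def b'_def c'_def d'_def f'_def by algebra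
  have 3: "c' * (f' - c') + e * (a' - d') = r22"
    unfolding assms(1-3) a'_def b'_def c'_def d'_def f'_def by algebra
  have 4: "d' * (a' - d') + b' * (f' - c') = 0" "c' * d' - b' * e = 0"
    unfolding 1 2 by (simp_all add: r11 r12)
  \<comment> \<open>\<open>b' r22\<close> and \<open>d' r22\<close> are \<open>c'\<close> and \<open>e\<close> times the vanishing component of the Ricci tensor along its kernel.\<close>
  have "b' * r22 = 0" "d' * r22 = 0"
    using 4 3 by algebra+
  then have "b' = 0" "d' = 0"
    using nz by auto
  then have l: "a * u + b = f' * u * u" "c * u + d = f' * u"
    unfolding b'_def d'_def by algebra+
  have "e * u + f = f'"
    by (simp add: f'_def)
  with l r11 r12 show ?thesis
    by (intro exI[of _ u] exI[of _ f'] conjI)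
qed

lemma ricci_constant_gradient_algebra:
  fixes a b c d e f :: real
  assumes "a * x + b * y = d * (a - d) + b * (f - c)"
    and "c * x + d * y = c * d - b * e"
    and "e * x + f * y = c * (f - c) + e * (a - d)"
  shows "(d * (a - d) + b * (f - c)) * (c * (f - c) + e * (a - d)) = (c * d - b * e) * (c * d - b * e)"
  \<comment> \<open>If \<open>(x, y)\<close> is zero, all components vanish. Otherwise, in a basis
    where it is \<open>(0, 1)\<close>, the hypotheses read \<open>b = r11\<close>,
    \<open>d = r12\<close>, \<open>f = r22\<close>; elimination gives \<open>b = 0\<close> and then
    \<open>d = 0\<close>.\<close>
  using assms by algebra

text \<open>The hypotheses say that the mixed second derivatives of the two components \<open>x\<close> and \<open>y\<close> of the
  gradient of a soliton function agree; by Cramer's rule they determine \<open>x\<close> and \<open>y\<close>.\<close>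

lemma ricci_integrability_algebra:
  fixes a b c d e f :: real
  defines "r11 \<equiv> d * (a - d) + b * (f - c)"
    and "r12 \<equiv> c * d - b * e"
    and "r22 \<equiv> c * (f - c) + e * (a - d)"
  assumes 1: "a * (c * x + d * y - r12) + b * (e * x + f * y - r22)
      = c * (a * x + b * y - r11) + d * (c * x + d * y - r12)"
    and 2: "c * (c * x + d * y - r12) + d * (e * x + f * y - r22)
      = e * (a * x + b * y - r11) + f * (c * x + d * y - r12)"
  shows "(r11 * r22 - r12 * r12) * x
      = r12 * (a * r12 + b * r22 - c * r11 - d * r12) - r11 * (c * r12 + d * r22 - e * r11 - f * r12)"
    and "(r11 * r22 - r12 * r12) * y
      = r22 * (a * r12 + b * r22 - c * r11 - d * r12) - r12 * (c * r12 + d * r22 - e * r11 - f * r12)"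
  using 1 2 unfolding assms(1-3) by algebra+

lemma ricci_coeff_components:
  assumes "\<And>i j k. \<Gamma> i j k = \<Gamma> j i k"
  shows "ricci_coeff \<Gamma> 1 1 = \<Gamma> 1 2 2 * (\<Gamma> 1 1 1 - \<Gamma> 1 2 2) + \<Gamma> 1 1 2 * (\<Gamma> 2 2 2 - \<Gamma> 1 2 1)"
    and "ricci_coeff \<Gamma> 1 2 = \<Gamma> 1 2 1 * \<Gamma> 1 2 2 - \<Gamma> 1 1 2 * \<Gamma> 2 2 1"
    and "ricci_coeff \<Gamma> 2 2 = \<Gamma> 1 2 1 * (\<Gamma> 2 2 2 - \<Gamma> 1 2 1) + \<Gamma> 2 2 1 * (\<Gamma> 1 1 1 - \<Gamma> 1 2 2)"
  using assms[of 2 1] by (simp_all add: ricci_coeff_def sum_2 algebra_simps)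

lemma ricci_coeff_rank_one_factorization:
  assumes sym: "\<And>i j k. \<Gamma> i j k = \<Gamma> j i k"
    and det: "ricci_coeff \<Gamma> 1 1 * ricci_coeff \<Gamma> 2 2 = ricci_coeff \<Gamma> 1 2 * ricci_coeff \<Gamma> 2 1"
    and nz: "ricci_coeff \<Gamma> i j \<noteq> 0"
  obtains s \<mu> :: real and l :: plane where "\<And>i j. ricci_coeff \<Gamma> i j = s * l $ i * l $ j"
    and "\<And>x y. l \<bullet> christoffel_map \<Gamma> x y = \<mu> * (l \<bullet> x) * (l \<bullet> y)"
proof -
  note ric = ricci_coeff_components[of \<Gamma>, OF sym]
  have ric21: "ricci_coeff \<Gamma> 2 1 = ricci_coeff \<Gamma> 1 2"
    by (rule ricci_coeff_symmetric[of \<Gamma>, OF sym])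
  have "\<exists>s \<mu> l1 l2. ricci_coeff \<Gamma> 1 1 = s * l1 * l1 \<and>
      ricci_coeff \<Gamma> 1 2 = s * l1 * l2 \<and>
      ricci_coeff \<Gamma> 2 2 = s * l2 * l2 \<and>
      \<Gamma> 1 1 1 * l1 + \<Gamma> 1 1 2 * l2 = \<mu> * l1 * l1 \<and>
      \<Gamma> 1 2 1 * l1 + \<Gamma> 1 2 2 * l2 = \<mu> * l1 * l2 \<and>
      \<Gamma> 2 2 1 * l1 + \<Gamma> 2 2 2 * l2 = \<mu> * l2 * l2"
  \<comment> \<open>A nonzero symmetric matrix of determinant zero has a nonzero diagonal entry, so
    exchanging the two coordinates handles the second case.\<close>
  proof (cases "ricci_coeff \<Gamma> 2 2 = 0")
    case False
    obtain u \<mu> where "ricci_coeff \<Gamma> 1 1 = ricci_coeff \<Gamma> 2 2 * u * u" "ricci_coeff \<Gamma> 1 2 = ricci_coeff \<Gamma> 2 2 * u"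
      "\<Gamma> 1 1 1 * u + \<Gamma> 1 1 2 = \<mu> * u * u" "\<Gamma> 1 2 1 * u + \<Gamma> 1 2 2 = \<mu> * u"
      "\<Gamma> 2 2 1 * u + \<Gamma> 2 2 2 = \<mu>"
      using ricci_rank_one_algebra[where a = "\<Gamma> 1 1 1" and b = "\<Gamma> 1 1 2" and c = "\<Gamma> 1 2 1" and d = "\<Gamma> 1 2 2"
          and e = "\<Gamma> 2 2 1" and f = "\<Gamma> 2 2 2"]
        det False unfolding ric21 ric[symmetric] by blast
    then show ?thesis
      by (intro exI[of _ "ricci_coeff \<Gamma> 2 2"] exI[of _ \<mu>] exI[of _ u] exI[of _ 1]) simp
  next
    case True
    have nz': "ricci_coeff \<Gamma> 1 1 \<noteq> 0"
      using True det nz ric21 exhaust_2[of i] exhaust_2[of j] by auto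
    have ric12: "ricci_coeff \<Gamma> 1 2 = \<Gamma> 1 2 2 * \<Gamma> 1 2 1 - \<Gamma> 2 2 1 * \<Gamma> 1 1 2"
      by (simp add: ric)
    have det': "ricci_coeff \<Gamma> 2 2 * ricci_coeff \<Gamma> 1 1 = ricci_coeff \<Gamma> 1 2 * ricci_coeff \<Gamma> 1 2"
      using det by (simp add: ric21 mult.commute)
    obtain u \<mu> where "ricci_coeff \<Gamma> 2 2 = ricci_coeff \<Gamma> 1 1 * u * u" "ricci_coeff \<Gamma> 1 2 = ricci_coeff \<Gamma> 1 1 * u"
      "\<Gamma> 2 2 2 * u + \<Gamma> 2 2 1 = \<mu> * u * u" "\<Gamma> 1 2 2 * u + \<Gamma> 1 2 1 = \<mu> * u"
      "\<Gamma> 1 1 2 * u + \<Gamma> 1 1 1 = \<mu>"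
      using ricci_rank_one_algebra[where a = "\<Gamma> 2 2 2" and b = "\<Gamma> 2 2 1" and c = "\<Gamma> 1 2 2" and d = "\<Gamma> 1 2 1"
          and e = "\<Gamma> 1 1 2" and f = "\<Gamma> 1 1 1"]
        det' nz' unfolding ric(1,3)[symmetric] ric12[symmetric] by blast
    then show ?thesis
      by (intro exI[of _ "ricci_coeff \<Gamma> 1 1"] exI[of _ \<mu>] exI[of _ 1] exI[of _ u]) (simp add: algebra_simps)
  qed
  then obtain s \<mu> l1 l2
    where r: "ricci_coeff \<Gamma> 1 1 = s * l1 * l1" "ricci_coeff \<Gamma> 1 2 = s * l1 * l2"
        "ricci_coeff \<Gamma> 2 2 = s * l2 * l2"
      and g: "\<Gamma> 1 1 1 * l1 + \<Gamma> 1 1 2 * l2 = \<mu> * l1 * l1"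
        "\<Gamma> 1 2 1 * l1 + \<Gamma> 1 2 2 * l2 = \<mu> * l1 * l2"
        "\<Gamma> 2 2 1 * l1 + \<Gamma> 2 2 2 * l2 = \<mu> * l2 * l2"
    by blast
  define l :: plane where "l = vector [l1, l2]"
  have l: "l $ 1 = l1" "l $ 2 = l2"
    by (simp_all add: l_def)
  show thesis
  proof
    show "ricci_coeff \<Gamma> i j = s * l $ i * l $ j" for i j
      using r ric21 exhaust_2[of i] exhaust_2[of j] by (auto simp: l)
    show "l \<bullet> christoffel_map \<Gamma> x y = \<mu> * (l \<bullet> x) * (l \<bullet> y)" for x y
    proof -
      have "l \<bullet> christoffel_map \<Gamma> x y = x$1 * y$1 * (\<Gamma> 1 1 1 * l1 + \<Gamma> 1 1 2 * l2)
          + (x$1 * y$2 + x$2 * y$1) * (\<Gamma> 1 2 1 * l1 + \<Gamma> 1 2 2 * l2)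
          + x$2 * y$2 * (\<Gamma> 2 2 1 * l1 + \<Gamma> 2 2 2 * l2)"
        using sym[of 2 1] by (simp add: christoffel_map_def inner_vec_def sum_2 l algebra_simps)
      also have "\<dots> = \<mu> * (l \<bullet> x) * (l \<bullet> y)"
        unfolding g by (simp add: inner_vec_def sum_2 l algebra_simps)
      finally show ?thesis .
    qed
  qed
qed

section \<open>Affine gradient Ricci solitons\<close>

lemma has_derivative_quadratic:
  fixes l :: "'a::euclidean_space" and \<alpha> \<beta> :: real
  shows "((\<lambda>x. \<alpha> * (l \<bullet> x) + \<beta> * (l \<bullet> x)\<^sup>2) has_derivative (\<lambda>v. (\<alpha> + 2 * \<beta> * (l \<bullet> p)) * (l \<bullet> v))) (at p)"
  by (auto intro!: derivative_eq_intros simp: algebra_simps power2_eq_square)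

lemma C_diff_affine:
  fixes l :: "'a::euclidean_space" and c :: real
  shows "C_diff n (\<lambda>x. c + l \<bullet> x)"
proof (cases n)
  case (Suc m)
  have D: "((\<lambda>x. c + l \<bullet> x) has_derivative (\<lambda>v. l \<bullet> v)) (at x)" for x
    by (auto intro!: derivative_eq_intros)
  show ?thesis
    using smooth_const[where c = "l \<bullet> _"]
    by (auto simp: Suc frechet_derivative_eq[OF D] smooth_def intro!: differentiableI[OF D])
qed (auto intro!: continuous_intros)

lemma smooth_quadratic:
  fixes l :: "'a::euclidean_space" and \<alpha> \<beta> :: real
  shows "smooth (\<lambda>x. \<alpha> * (l \<bullet> x) + \<beta> * (l \<bullet> x)\<^sup>2)"
proof -
  have "C_diff n (\<lambda>x. \<alpha> * (l \<bullet> x) + \<beta> * (l \<bullet> x)\<^sup>2)" for n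
  proof (cases n)
    case (Suc m)
    have "C_diff m (\<lambda>x. (\<alpha> + 2 * \<beta> * (l \<bullet> x)) * (l \<bullet> b))" for b
      using C_diff_affine[of m "\<alpha> * (l \<bullet> b)" "(2 * \<beta> * (l \<bullet> b)) *\<^sub>R l"] by (simp add: algebra_simps)
    then show ?thesis
      by (auto simp: Suc frechet_derivative_eq[OF has_derivative_quadratic]
          intro: differentiableI[OF has_derivative_quadratic])
  qed (auto intro!: continuous_intros)
  then show ?thesis
    by (simp add: smooth_def)
qed

section \<open>The soliton equation\<close>

lemma affine_soliton_if_rank_one:
  assumes sym: "\<And>i j k. \<Gamma> i j k = \<Gamma> j i k"
    and "ricci_coeff \<Gamma> 1 1 * ricci_coeff \<Gamma> 2 2 = ricci_coeff \<Gamma> 1 2 * ricci_coeff \<Gamma> 2 1" "ricci_coeff \<Gamma> i j \<noteq> 0"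
  shows "affine_solitons \<Gamma> \<noteq> {}"
proof -
  obtain s \<mu> :: real and l :: plane where r: "\<And>i j. ricci_coeff \<Gamma> i j = s * l $ i * l $ j"
    and g: "\<And>x y. l \<bullet> christoffel_map \<Gamma> x y = \<mu> * (l \<bullet> x) * (l \<bullet> y)"
    using ricci_coeff_rank_one_factorization[of \<Gamma> i j, OF assms] by metis
  \<comment> \<open>These are the two coefficients of the differential equation for
    \<open>\<alpha> * t + \<beta> * t^2\<close>. In both uses of \<open>that\<close>, the first
    value is for \<open>\<beta>\<close>.\<close>
  obtain \<alpha> \<beta> :: real where \<alpha>\<beta>: "\<beta> * \<mu> = 0" "2 * \<beta> - \<alpha> * \<mu> + s = 0"
  proof (cases "\<mu> = 0")
    case True
    then show ?thesis by (intro that[of "- s / 2" 0]) auto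
  next
    case False
    then show ?thesis by (intro that[of 0 "s / \<mu>"]) auto
  qed
  define f :: "plane \<Rightarrow> real" where "f = (\<lambda>x. \<alpha> * (l \<bullet> x) + \<beta> * (l \<bullet> x)\<^sup>2)"
  have f: "smooth f"
    unfolding f_def by (rule smooth_quadratic)
  have df: "frechet_derivative f (at q) = (\<lambda>v. (\<alpha> + 2 * \<beta> * (l \<bullet> q)) * (l \<bullet> v))" for q
    unfolding f_def by (rule frechet_derivative_eq[OF has_derivative_quadratic])
  have "((\<lambda>q. frechet_derivative f (at q) w) has_derivative (\<lambda>v. 2 * \<beta> * (l \<bullet> v) * (l \<bullet> w))) (at p)" for p w
    unfolding df by (auto intro!: derivative_eq_intros)
  note ddf = frechet_derivative_eq[OF this]
  have ricci: "ricci \<Gamma> X Y p = s * (l \<bullet> X p) * (l \<bullet> Y p)" if "smooth X" "smooth Y" for X Y p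
    unfolding ricci_eq[OF that] r by (simp add: inner_vec_def sum_2 algebra_simps)
  have "hessian \<Gamma> f X Y p + ricci_sym \<Gamma> X Y p = 0" if X: "smooth X" and Y: "smooth Y" for X Y p
  proof -
    have "hessian \<Gamma> f X Y p + ricci_sym \<Gamma> X Y p
        = (2 * \<beta> - \<alpha> * \<mu> + s - 2 * (\<beta> * \<mu>) * (l \<bullet> p)) * (l \<bullet> X p) * (l \<bullet> Y p)"
      unfolding hessian_eq[OF f Y] ddf ricci_sym_def ricci[OF X Y] ricci[OF Y X]
      by (simp add: df g algebra_simps)
    then show ?thesis
      by (simp add: \<alpha>\<beta>)
  qed
  with f have "f \<in> affine_solitons \<Gamma>"
    by (simp add: affine_solitons_def tensor_zero_def)
  then show ?thesis
    by blast
qed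

lemma det_ricci_coeff_eq_0_if_affine_soliton:
  assumes sym: "\<And>i j k. \<Gamma> i j k = \<Gamma> j i k" and f: "f \<in> affine_solitons \<Gamma>"
  shows "ricci_coeff \<Gamma> 1 1 * ricci_coeff \<Gamma> 2 2 = ricci_coeff \<Gamma> 1 2 * ricci_coeff \<Gamma> 2 1"
proof (rule ccontr)
  assume det: "ricci_coeff \<Gamma> 1 1 * ricci_coeff \<Gamma> 2 2 \<noteq> ricci_coeff \<Gamma> 1 2 * ricci_coeff \<Gamma> 2 1"
  note ric = ricci_coeff_components[of \<Gamma>, OF sym]
  have ric_sym: "ricci_coeff \<Gamma> i j = ricci_coeff \<Gamma> j i" for i j
    by (rule ricci_coeff_symmetric[of \<Gamma>, OF sym])
  have "smooth f"
    using f by (simp add: affine_solitons_def)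
  define e :: "2 \<Rightarrow> plane" where "e = (\<lambda>i. axis i 1)"
  define g where "g = (\<lambda>j q. frechet_derivative f (at q) (e j))"
  define D where "D = (\<lambda>i h p. frechet_derivative h (at p) (e i) :: real)"
  have smooth_g: "smooth (g j)" for j
    unfolding g_def e_def using \<open>smooth f\<close> by (intro smooth_frechet_derivative) (auto simp: axis_in_Basis_iff)
  have g': "(g j has_derivative frechet_derivative (g j) (at p)) (at p)" for j p
    using smooth_g by (simp add: frechet_derivative_works[symmetric] smooth_differentiable)
  have Dg: "D i (g j) p = \<Gamma> i j 1 * g 1 p + \<Gamma> i j 2 * g 2 p - ricci_coeff \<Gamma> i j" for i j p
  proof -
    have lin: "linear (frechet_derivative f (at p))"
      using \<open>smooth f\<close> by (intro linear_frechet_derivative smooth_differentiable)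
    have "christoffel_map \<Gamma> (e i) (e j) = \<Gamma> i j 1 *\<^sub>R e 1 + \<Gamma> i j 2 *\<^sub>R e 2"
      using exhaust_2[of i] exhaust_2[of j]
      by (auto simp: vec_eq_iff forall_2 christoffel_map_def sum_2 e_def axis_def)
    then have "frechet_derivative f (at p) (christoffel_map \<Gamma> (e i) (e j)) = \<Gamma> i j 1 * g 1 p + \<Gamma> i j 2 * g 2 p"
      by (simp add: linear_add[OF lin] linear_cmul[OF lin] g_def)
    moreover have "hessian \<Gamma> f (coord_field i) (coord_field j) p + ricci_sym \<Gamma> (coord_field i) (coord_field j) p = 0"
      using f smooth_coord_field unfolding affine_solitons_def tensor_zero_def by blast
    ultimately show ?thesis
      unfolding hessian_eq[OF \<open>smooth f\<close> smooth_coord_field] ricci_sym_def ricci_coord_field ric_sym[of j i]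
      by (simp add: coord_field_def D_def g_def e_def)
  qed
  have DDg: "D k (\<lambda>q. D i (g j) q) p = \<Gamma> i j 1 * D k (g 1) p + \<Gamma> i j 2 * D k (g 2) p" for i j k p
  proof -
    have "D i (g j) = (\<lambda>q. \<Gamma> i j 1 * g 1 q + \<Gamma> i j 2 * g 2 q - ricci_coeff \<Gamma> i j)"
      by (simp add: fun_eq_iff Dg)
    moreover have "((\<lambda>q. \<Gamma> i j 1 * g 1 q + \<Gamma> i j 2 * g 2 q - ricci_coeff \<Gamma> i j) has_derivative
        (\<lambda>v. \<Gamma> i j 1 * frechet_derivative (g 1) (at p) v + \<Gamma> i j 2 * frechet_derivative (g 2) (at p) v - 0)) (at p)"
      by (intro has_derivative_diff has_derivative_add has_derivative_mult_right has_derivative_const g')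
    ultimately show ?thesis
      by (simp add: D_def frechet_derivative_eq)
  qed
  \<comment> \<open>Both sides are mixed second derivatives of \<open>g j\<close>; the constant
    Ricci coefficients have dropped out.\<close>
  have commute: "\<Gamma> 1 j 1 * D 2 (g 1) p + \<Gamma> 1 j 2 * D 2 (g 2) p
      = \<Gamma> 2 j 1 * D 1 (g 1) p + \<Gamma> 2 j 2 * D 1 (g 2) p" for j p
    unfolding DDg[symmetric] unfolding D_def
    by (rule C_diff_second_derivative_symmetric[OF smooth_C_diff_2[OF smooth_g]])
  have compat: "\<Gamma> 1 1 1 * (\<Gamma> 1 2 1 * g 1 p + \<Gamma> 1 2 2 * g 2 p - ricci_coeff \<Gamma> 1 2)
        + \<Gamma> 1 1 2 * (\<Gamma> 2 2 1 * g 1 p + \<Gamma> 2 2 2 * g 2 p - ricci_coeff \<Gamma> 2 2)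
      = \<Gamma> 1 2 1 * (\<Gamma> 1 1 1 * g 1 p + \<Gamma> 1 1 2 * g 2 p - ricci_coeff \<Gamma> 1 1)
        + \<Gamma> 1 2 2 * (\<Gamma> 1 2 1 * g 1 p + \<Gamma> 1 2 2 * g 2 p - ricci_coeff \<Gamma> 1 2)"
    "\<Gamma> 1 2 1 * (\<Gamma> 1 2 1 * g 1 p + \<Gamma> 1 2 2 * g 2 p - ricci_coeff \<Gamma> 1 2)
        + \<Gamma> 1 2 2 * (\<Gamma> 2 2 1 * g 1 p + \<Gamma> 2 2 2 * g 2 p - ricci_coeff \<Gamma> 2 2)
      = \<Gamma> 2 2 1 * (\<Gamma> 1 1 1 * g 1 p + \<Gamma> 1 1 2 * g 2 p - ricci_coeff \<Gamma> 1 1)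
        + \<Gamma> 2 2 2 * (\<Gamma> 1 2 1 * g 1 p + \<Gamma> 1 2 2 * g 2 p - ricci_coeff \<Gamma> 1 2)"
    for p
    by (fact commute[of 1 p, unfolded Dg sym[of 2 1] ric_sym[of 2 1]]
        commute[of 2 p, unfolded Dg sym[of 2 1] ric_sym[of 2 1]])+
  have "\<exists>c. \<forall>p. g j p = c" for j
  proof -
    have det': "ricci_coeff \<Gamma> 1 1 * ricci_coeff \<Gamma> 2 2 - ricci_coeff \<Gamma> 1 2 * ricci_coeff \<Gamma> 1 2 \<noteq> 0"
      using det ric_sym[of 2 1] by simp
    \<comment> \<open>The right-hand sides of these formulas for \<open>g 1 p\<close> and
      \<open>g 2 p\<close> do not involve \<open>p\<close>, so a nonzero determinant makes the
      gradient constant.\<close>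
    note sol = ricci_integrability_algebra[where a = "\<Gamma> 1 1 1" and b = "\<Gamma> 1 1 2" and c = "\<Gamma> 1 2 1" and d = "\<Gamma> 1 2 2"
        and e = "\<Gamma> 2 2 1" and f = "\<Gamma> 2 2 2", folded ric, OF compat]
    have "\<exists>k. \<forall>p. (ricci_coeff \<Gamma> 1 1 * ricci_coeff \<Gamma> 2 2 - ricci_coeff \<Gamma> 1 2 * ricci_coeff \<Gamma> 1 2) * g j p = k"
      using exhaust_2[of j]
    proof
      assume "j = 1"
      then show ?thesis
        by (simp only:) (rule exI, rule allI, rule sol(1))
    next
      assume "j = 2"
      then show ?thesis
        by (simp only:) (rule exI, rule allI, rule sol(2))
    qed
    then obtain k
      where "(ricci_coeff \<Gamma> 1 1 * ricci_coeff \<Gamma> 2 2 - ricci_coeff \<Gamma> 1 2 * ricci_coeff \<Gamma> 1 2) * g j p = k" for p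
      by blast
    then have "g j p = k / (ricci_coeff \<Gamma> 1 1 * ricci_coeff \<Gamma> 2 2 - ricci_coeff \<Gamma> 1 2 * ricci_coeff \<Gamma> 1 2)" for p
      using det' by (metis nonzero_mult_div_cancel_left)
    then show ?thesis
      by blast
  qed
  then obtain c where c: "\<And>j p. g j p = c j"
    by metis
  have "D i (g j) p = 0" for i j p
  proof -
    have "g j = (\<lambda>_. c j)"
      by (simp add: fun_eq_iff c)
    then show ?thesis
      by (simp add: D_def)
  qed
  then have "\<Gamma> i j 1 * c 1 + \<Gamma> i j 2 * c 2 = ricci_coeff \<Gamma> i j" for i j
    using Dg[of i j 0] by (simp add: c)
  from ricci_constant_gradient_algebra[OF this[of 1 1, unfolded ric] this[of 1 2, unfolded ric]
      this[of 2 2, unfolded ric]]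
  show False
    using det unfolding ric ric_sym[of 2 1] by simp
qed

theorem theorem4p3:
  fixes \<Gamma> :: "2 \<Rightarrow> 2 \<Rightarrow> 2 \<Rightarrow> real"
  assumes "torsion_free \<Gamma>"
    and "\<not> tensor_zero (ricci \<Gamma>)"
  shows "(\<forall>p. tensor_rank (ricci \<Gamma>) p = 1) \<longleftrightarrow> affine_solitons \<Gamma> \<noteq> {}"
proof -
  have sym: "\<Gamma> i j k = \<Gamma> j i k" for i j k
    by (rule torsion_free_symmetric[OF assms(1)])
  have "tensor_zero (ricci \<Gamma>)" if "\<forall>i j. ricci_coeff \<Gamma> i j = 0"
    using that by (simp add: tensor_zero_def ricci_eq)
  with assms(2) obtain i j where nz: "ricci_coeff \<Gamma> i j \<noteq> 0"
    by blast
  show ?thesis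
  proof
    assume "\<forall>p. tensor_rank (ricci \<Gamma>) p = 1"
    then have "ricci_coeff \<Gamma> 1 1 * ricci_coeff \<Gamma> 2 2 = ricci_coeff \<Gamma> 1 2 * ricci_coeff \<Gamma> 2 1"
      unfolding tensor_rank_ricci by blast
    then show "affine_solitons \<Gamma> \<noteq> {}"
      using nz by (rule affine_soliton_if_rank_one[of \<Gamma>, OF sym])
  next
    assume "affine_solitons \<Gamma> \<noteq> {}"
    then obtain f where "f \<in> affine_solitons \<Gamma>"
      by blast
    then have "ricci_coeff \<Gamma> 1 1 * ricci_coeff \<Gamma> 2 2 = ricci_coeff \<Gamma> 1 2 * ricci_coeff \<Gamma> 2 1"
      by (rule det_ricci_coeff_eq_0_if_affine_soliton[of \<Gamma>, OF sym])
    \<comment> \<open>The coefficients are the same at every point, hence so is the rank.\<close>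
    with nz show "\<forall>p. tensor_rank (ricci \<Gamma>) p = 1"
      unfolding tensor_rank_ricci by blast
  qed
qed

end
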